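(* Let $q$ be a complex number with $|q|<1$ and let $x$ and $y$ be complex numbers. Then \[ \sum_{j,\,k\geq0}\frac{q^{j^2+2jk+2k^2-j-k}}{(q;q)_j(q^2;q^2)_k}x^{j}y^{2k} =(y;q)_{\infty} \sum_{k=0}^{\infty}\frac{(-x/y;q)_k}{(q;q)_k(y;q)_k}q^{\binom{k}{2}}y^k. \]
   Context: For complex $a$ and $|q|<1$, $(a;q)_\infty=\prod_{i=0}^{\infty}(1-aq^i)$ and, for a nonnegative integer $n$, $(a;q)_n=(a;q)_\infty/(aq^n;q)_\infty$. Also $\binom{k}{2}=k(k-1)/2$. *)

theory Defs
  imports "HOL-Analysis.Analysis"
begin

definition qpoch_inf :: "complex \<Rightarrow> complex \<Rightarrow> complex" where
  "qpoch_inf a q = (\<Prod>i. 1 - a * q ^ i)"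

text \<open>
  For \<open>norm q < 1\<close> the finite symbol is the quotient
  \<open>qpoch_inf a q / qpoch_inf (a * q ^ n) q\<close> whenever the denominator is nonzero
  (lemma \<open>qpoch_eq_quotient\<close> below).  The finite product also gives the intended
  value when the quotient is of the form 0/0, i.e. when \<open>a * q ^ (n + m) = 1\<close>
  for some \<open>m\<close>.
\<close>

definition qpoch :: "complex \<Rightarrow> complex \<Rightarrow> nat \<Rightarrow> complex" where
  "qpoch a q n = (\<Prod>i<n. 1 - a * q ^ i)"

lemma convergent_prod_qpoch_inf:
  assumes "norm q < 1"
  shows "convergent_prod (\<lambda>i. 1 - a * q ^ i :: complex)"
proof -
  have "summable (\<lambda>i. norm (a * q ^ i))"
    using assms by (simp add: norm_mult norm_power summable_mult summable_geometric)
  hence "abs_convergent_prod (\<lambda>i. 1 - a * q ^ i)"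
    by (simp add: abs_convergent_prod_conv_summable)
  thus ?thesis by (rule abs_convergent_prod_imp_convergent_prod)
qed

lemma qpoch_inf_split:
  assumes "norm q < 1"
  shows "qpoch_inf a q = qpoch a q n * qpoch_inf (a * q ^ n) q"
proof -
  have 1: "(\<lambda>m. \<Prod>i\<le>m. 1 - b * q ^ i) \<longlonglongrightarrow> qpoch_inf b q" for b
    unfolding qpoch_inf_def by (rule convergent_prod_LIMSEQ[OF convergent_prod_qpoch_inf[OF assms]])
  have 2: "(\<lambda>m. \<Prod>i<m. 1 - b * q ^ i) \<longlonglongrightarrow> qpoch_inf b q" for b
    using 1[of b] by (subst filterlim_sequentially_Suc[symmetric]) (simp add: lessThan_Suc_atMost)
  have "(\<Prod>i<m + n. 1 - a * q ^ i) = qpoch a q n * (\<Prod>i<m. 1 - (a * q ^ n) * q ^ i)" for m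
    unfolding qpoch_def
    by (induction m) (auto simp: power_add mult_ac)
  moreover have "(\<lambda>m. qpoch a q n * (\<Prod>i<m. 1 - (a * q ^ n) * q ^ i))
      \<longlonglongrightarrow> qpoch a q n * qpoch_inf (a * q ^ n) q"
    by (intro tendsto_mult tendsto_const 2)
  moreover have "(\<lambda>m. \<Prod>i<m + n. 1 - a * q ^ i) \<longlonglongrightarrow> qpoch_inf a q"
    using LIMSEQ_ignore_initial_segment[OF 2[of a]] .
  ultimately show ?thesis by (simp add: LIMSEQ_unique)
qed

lemma qpoch_eq_quotient:
  assumes "norm q < 1" and "qpoch_inf (a * q ^ n) q \<noteq> 0"
  shows "qpoch a q n = qpoch_inf a q / qpoch_inf (a * q ^ n) q"
  using qpoch_inf_split[OF assms(1), of a n] assms(2) by simp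

definition lhs_term :: "complex \<Rightarrow> complex \<Rightarrow> complex \<Rightarrow> nat \<times> nat \<Rightarrow> complex" where
  "lhs_term q x y = (\<lambda>(j, k).
     q ^ (j^2 + 2*j*k + 2*k^2 - j - k) / (qpoch q q j * qpoch (q^2) (q^2) k) * x ^ j * y ^ (2*k))"

definition rhs_term :: "complex \<Rightarrow> complex \<Rightarrow> complex \<Rightarrow> nat \<Rightarrow> complex" where
  "rhs_term q x y k =
     qpoch (- x / y) q k / (qpoch q q k * qpoch y q k) * q ^ (k choose 2) * y ^ k"

text \<open>
  The parameter \<open>y\<close> is regular if no summand of the right-hand side contains a
  division by zero, i.e. \<open>y \<noteq> 0\<close> and \<open>y * q ^ i \<noteq> 1\<close> for all \<open>i\<close>.
  The other values of \<open>y\<close> are removable singularities of the right-hand side,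
  which is then understood as its limit at \<open>y\<close>.
\<close>

definition regular :: "complex \<Rightarrow> complex \<Rightarrow> bool" where
  "regular q y \<longleftrightarrow> y \<noteq> 0 \<and> (\<forall>k. qpoch y q k \<noteq> 0)"

text \<open>The exponent on the left is a truncated subtraction in \<open>nat\<close>, but nothing is cut off:\<close>

lemma lhs_exponent:
  "int (j^2 + 2*j*k + 2*k^2 - j - k) = int j^2 + 2*int j*int k + 2*int k^2 - int j - int k"
proof -
  have "j \<le> j^2" "k \<le> k^2" by (auto simp: power2_eq_square)
  hence "j + k \<le> j^2 + 2*j*k + 2*k^2" by linarith
  thus ?thesis by (simp add: of_nat_diff algebra_simps)
qed

end

theory Submission
  imports Defs
begin

text \<open>
  Multiplying the right-hand side by \<open>(y;q)\<^sub>\<infinity>\<close> turns its \<open>k\<close>-th term into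
  \<open>q\<^bsup>k(k-1)/2\<^esup> \<Prod>\<^bsub>i<k\<^esub> (y + x q\<^sup>i) (y q\<^sup>k;q)\<^sub>\<infinity> / (q;q)\<^sub>k\<close>, which is entire in \<open>y\<close>.
  Expanding the finite product by the \<open>q\<close>-binomial theorem (indices \<open>j + r = k\<close>) and the
  infinite one by Euler's series (index \<open>m\<close>) gives an absolutely convergent triple series.
  Its \<open>q\<close>-exponent depends only on \<open>j\<close> and \<open>n = r + m\<close>, so summing over
  \<open>r + m = n\<close> first leaves \<open>\<Sum>\<^bsub>m\<le>n\<^esub> (-1)\<^sup>m / ((q;q)\<^sub>m (q;q)\<^bsub>n-m\<^esub>)\<close>, which vanishes for odd \<open>n\<close>
  and is \<open>1 / (q\<^sup>2;q\<^sup>2)\<^sub>k\<close> for \<open>n = 2k\<close>; this is the left-hand side.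
  At a non-regular \<open>y\<close> the identity holds on a punctured neighbourhood, and the left-hand side is
  continuous, being a power series in \<open>y\<^sup>2\<close>.
\<close>

section \<open>Finite \<open>q\<close>-Pochhammer symbols and their reciprocals\<close>

definition rqfact :: "complex \<Rightarrow> nat \<Rightarrow> complex" where
  "rqfact q n = inverse (qpoch q q n)"

lemma qpoch_0 [simp]: "qpoch a q 0 = 1"
  by (simp add: qpoch_def)

lemma qpoch_Suc: "qpoch a q (Suc n) = qpoch a q n * (1 - a * q ^ n)"
  by (simp add: qpoch_def)

lemma one_minus_power_nonzero:
  fixes q :: complex
  assumes "norm q < 1" "n > 0"
  shows "1 - q ^ n \<noteq> 0"
proof -
  have "norm (q ^ n) < 1"
    using assms by (simp add: norm_power power_less_one_iff)
  thus ?thesis by auto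
qed

lemma qpoch_self_nonzero: "norm q < 1 \<Longrightarrow> qpoch q q n \<noteq> 0"
  using one_minus_power_nonzero[of q "Suc i" for i] by (auto simp: qpoch_def)

lemma qpoch_inf_nonzero:
  assumes "norm q < 1" "\<And>n. qpoch a q n \<noteq> 0"
  shows "qpoch_inf a q \<noteq> 0"
  unfolding qpoch_inf_def
proof (rule prodinf_nonzero[OF convergent_prod_qpoch_inf[OF assms(1)]])
  show "1 - a * q ^ i \<noteq> 0" for i
    using assms(2)[of "Suc i"] by (simp add: qpoch_Suc)
qed

lemma qpoch_tendsto:
  assumes "norm q < 1"
  shows "qpoch a q \<longlonglongrightarrow> qpoch_inf a q"
proof -
  have "(\<lambda>m. \<Prod>i\<le>m. 1 - a * q ^ i) \<longlonglongrightarrow> qpoch_inf a q"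
    unfolding qpoch_inf_def by (rule convergent_prod_LIMSEQ[OF convergent_prod_qpoch_inf[OF assms]])
  hence "(\<lambda>m. qpoch a q (Suc m)) \<longlonglongrightarrow> qpoch_inf a q"
    by (simp add: qpoch_def lessThan_Suc_atMost)
  thus ?thesis by (subst (asm) filterlim_sequentially_Suc)
qed

lemma rqfact_0 [simp]: "rqfact q 0 = 1"
  by (simp add: rqfact_def)

lemma rqfact_Suc:
  assumes "norm q < 1"
  shows "rqfact q (Suc n) * (1 - q ^ Suc n) = rqfact q n"
  using one_minus_power_nonzero[OF assms, of "Suc n"] by (simp add: rqfact_def qpoch_Suc)

text \<open>The symbols \<open>qpoch q q n\<close> are nonzero and tend to a nonzero limit, so their
  reciprocals converge. The constant \<open>C\<close> enters both majorants below.\<close>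

lemma rqfact_bounded:
  assumes "norm q < 1"
  obtains C where "C > 0" "\<And>n. norm (rqfact q n) \<le> C"
proof -
  have "(\<lambda>n. rqfact q n) \<longlonglongrightarrow> inverse (qpoch_inf q q)"
    unfolding rqfact_def
    by (intro tendsto_inverse qpoch_tendsto qpoch_inf_nonzero qpoch_self_nonzero assms)
  hence "Bseq (rqfact q)"
    by (intro convergent_imp_Bseq convergentI)
  thus ?thesis using that by (auto simp: Bseq_def)
qed

section \<open>Arithmetic and convergence for triangular exponents\<close>

lemma Suc_choose_two: "Suc n choose 2 = (n choose 2) + n"
  by (simp add: numeral_2_eq_2)

lemma add_choose_two: "(m + n) choose 2 = (m choose 2) + (n choose 2) + m * n"
  by (induction n) (auto simp: Suc_choose_two)

lemma square_eq_choose_two: "n\<^sup>2 = n + 2 * (n choose 2)"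
  by (induction n) (auto simp: Suc_choose_two power2_eq_square)

text \<open>Consecutive terms have ratio \<open>Q ^ n * Y\<close>, which tends to 0: the quadratic
  exponent beats any \<open>Y\<close>.\<close>

lemma summable_power_choose_two:
  fixes Q Y :: real
  assumes "0 \<le> Q" "Q < 1" "0 \<le> Y"
  shows "summable (\<lambda>n. Q ^ (n choose 2) * Y ^ n)"
proof -
  have "(\<lambda>n. Q ^ n * Y) \<longlonglongrightarrow> 0 * Y"
    using assms by (intro tendsto_mult LIMSEQ_power_zero tendsto_const) auto
  hence "eventually (\<lambda>n. Q ^ n * Y < 1/2) sequentially"
    by (rule order_tendstoD) simp
  then obtain N where N: "\<And>n. n \<ge> N \<Longrightarrow> Q ^ n * Y < 1/2"
    by (auto simp: eventually_sequentially)
  show ?thesis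
  proof (rule summable_ratio_test[of "1/2" N])
    fix n assume "n \<ge> N"
    hence "(Q ^ n * Y) * (Q ^ (n choose 2) * Y ^ n) \<le> 1/2 * (Q ^ (n choose 2) * Y ^ n)"
      using N[of n] assms by (intro mult_right_mono) auto
    thus "norm (Q ^ (Suc n choose 2) * Y ^ Suc n) \<le> 1/2 * norm (Q ^ (n choose 2) * Y ^ n)"
      using assms by (simp add: Suc_choose_two power_add abs_mult mult_ac)
  qed simp
qed

section \<open>Finite convolutions of reciprocal \<open>q\<close>-factorials\<close>

text \<open>Both finite identities below come from splitting \<open>1 - q\<^bsup>j+r\<^esup> = (1 - q\<^sup>r) + q\<^sup>r (1 - q\<^sup>j)\<close>.\<close>

lemma rqfact_convolution_Suc:
  assumes "norm q < 1"
  shows "(1 - q ^ Suc n) * (\<Sum>j\<le>Suc n. w j * rqfact q j * rqfact q (Suc n - j)) =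
         (\<Sum>j\<le>n. (w j + q ^ (n - j) * w (Suc j)) * rqfact q j * rqfact q (n - j))"
proof -
  let ?e = "rqfact q"
  have "(1 - q ^ Suc n) * (\<Sum>j\<le>Suc n. w j * ?e j * ?e (Suc n - j)) =
        (\<Sum>j\<le>Suc n. w j * ?e j * (?e (Suc n - j) * (1 - q ^ (Suc n - j)))) +
        (\<Sum>j\<le>Suc n. w j * q ^ (Suc n - j) * (?e j * (1 - q ^ j)) * ?e (Suc n - j))"
    unfolding sum_distrib_left sum.distrib[symmetric]
  proof (intro sum.cong refl)
    fix j assume "j \<in> {..Suc n}"
    hence "q ^ Suc n = q ^ (Suc n - j) * q ^ j"
      by (simp flip: power_add)
    thus "(1 - q ^ Suc n) * (w j * ?e j * ?e (Suc n - j)) =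
          w j * ?e j * (?e (Suc n - j) * (1 - q ^ (Suc n - j))) +
          w j * q ^ (Suc n - j) * (?e j * (1 - q ^ j)) * ?e (Suc n - j)"
      by (simp add: algebra_simps)
  qed
  \<comment> \<open>The summand at \<open>j = Suc n\<close> vanishes through
    \<open>1 - q ^ 0\<close>. In the second sum the one at \<open>j = 0\<close> does, which shifts
    the index there.\<close>
  also have "(\<Sum>j\<le>Suc n. w j * ?e j * (?e (Suc n - j) * (1 - q ^ (Suc n - j)))) =
             (\<Sum>j\<le>n. w j * ?e j * ?e (n - j))"
    by (subst sum.atMost_Suc) (auto intro!: sum.cong simp: Suc_diff_le rqfact_Suc[OF assms] simp del: power_Suc)
  also have "(\<Sum>j\<le>Suc n. w j * q ^ (Suc n - j) * (?e j * (1 - q ^ j)) * ?e (Suc n - j)) =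
             (\<Sum>j\<le>n. w (Suc j) * q ^ (n - j) * ?e j * ?e (n - j))"
    by (subst sum.atMost_Suc_shift) (simp add: rqfact_Suc[OF assms] del: power_Suc)
  finally show ?thesis
    by (simp only: sum.distrib[symmetric] ring_distribs mult_ac)
qed

text \<open>For these weights the combination in \<open>rqfact_convolution_Suc\<close> is
  \<open>y + x * q ^ k\<close> times the weight for \<open>k\<close>, so each induction step
  supplies one factor of the product. The form homogeneous in \<open>x\<close> and \<open>y\<close>
  also covers \<open>y = 0\<close>.\<close>

lemma q_binomial:
  assumes "norm q < 1"
  shows "(\<Sum>j\<le>k. q ^ (j choose 2) * x ^ j * y ^ (k - j) * rqfact q j * rqfact q (k - j)) =
         rqfact q k * (\<Prod>i<k. y + x * q ^ i)"
proof (induction k)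
  case 0
  show ?case by (simp add: numeral_2_eq_2)
next
  case (Suc k)
  define S where "S k = (\<Sum>j\<le>k. q ^ (j choose 2) * x ^ j * y ^ (k - j) * rqfact q j * rqfact q (k - j))" for k
  let ?w = "\<lambda>j. q ^ (j choose 2) * x ^ j * y ^ (Suc k - j)"
  have "(1 - q ^ Suc k) * S (Suc k) =
        (\<Sum>j\<le>k. (?w j + q ^ (k - j) * ?w (Suc j)) * rqfact q j * rqfact q (k - j))"
    unfolding S_def by (rule rqfact_convolution_Suc[OF assms, of k ?w])
  also have "\<dots> = (\<Sum>j\<le>k. (y + x * q ^ k) *
      (q ^ (j choose 2) * x ^ j * y ^ (k - j) * rqfact q j * rqfact q (k - j)))"
  proof (intro sum.cong refl)
    fix j assume "j \<in> {..k}"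
    hence "q ^ k = q ^ (k - j) * q ^ j" "Suc k - j = Suc (k - j)"
      by (auto simp flip: power_add)
    thus "(?w j + q ^ (k - j) * ?w (Suc j)) * rqfact q j * rqfact q (k - j) =
          (y + x * q ^ k) * (q ^ (j choose 2) * x ^ j * y ^ (k - j) * rqfact q j * rqfact q (k - j))"
      by (simp add: Suc_choose_two power_add algebra_simps)
  qed
  also have "\<dots> = (y + x * q ^ k) * S k"
    by (simp add: S_def sum_distrib_left)
  also have "S k = rqfact q k * (\<Prod>i<k. y + x * q ^ i)"
    using Suc.IH by (simp add: S_def)
  also have "rqfact q k = rqfact q (Suc k) * (1 - q ^ Suc k)"
    by (rule rqfact_Suc[OF assms, symmetric])
  finally have "(1 - q ^ Suc k) * S (Suc k) =
                (1 - q ^ Suc k) * (rqfact q (Suc k) * (\<Prod>i<Suc k. y + x * q ^ i))"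
    by (simp add: mult_ac del: power_Suc)
  hence "S (Suc k) = rqfact q (Suc k) * (\<Prod>i<Suc k. y + x * q ^ i)"
    using one_minus_power_nonzero[OF assms, of "Suc k"] by (simp del: power_Suc prod.lessThan_Suc)
  thus ?case by (simp only: S_def)
qed

text \<open>This is the coefficient of \<open>z ^ n\<close> in
  \<open>1 / ((z;q)_inf * (-z;q)_inf) = 1 / (z^2;q^2)_inf\<close>, which explains its values at odd
  and even \<open>n\<close>.\<close>

definition alternating_convolution :: "complex \<Rightarrow> nat \<Rightarrow> complex" where
  "alternating_convolution q n = (\<Sum>m\<le>n. (-1) ^ m * rqfact q m * rqfact q (n - m))"

text \<open>The weights \<open>(-1) ^ j\<close> combine to
  \<open>(-1) ^ j * (1 - q ^ (Suc n - j))\<close>, and the second factor lowers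
  \<open>rqfact q (Suc n - j)\<close> by one index. The total drop of two keeps even and odd indices
  apart.\<close>

lemma alternating_convolution_Suc_Suc:
  assumes "norm q < 1"
  shows "(1 - q ^ Suc (Suc n)) * alternating_convolution q (Suc (Suc n)) = alternating_convolution q n"
proof -
  have "(1 - q ^ Suc (Suc n)) * alternating_convolution q (Suc (Suc n)) =
        (\<Sum>j\<le>Suc n. ((-1) ^ j + q ^ (Suc n - j) * (-1) ^ Suc j) * rqfact q j * rqfact q (Suc n - j))"
    unfolding alternating_convolution_def by (rule rqfact_convolution_Suc[OF assms])
  also have "\<dots> = (\<Sum>j\<le>Suc n. (-1) ^ j * rqfact q j * (rqfact q (Suc n - j) * (1 - q ^ (Suc n - j))))"
    by (intro sum.cong) (auto simp: algebra_simps)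
  also have "\<dots> = alternating_convolution q n"
    unfolding alternating_convolution_def
    by (subst sum.atMost_Suc) (auto intro!: sum.cong simp: Suc_diff_le rqfact_Suc[OF assms] simp del: power_Suc)
  finally show ?thesis .
qed

lemma alternating_convolution_odd:
  assumes "norm q < 1"
  shows "alternating_convolution q (Suc (2 * k)) = 0"
proof (induction k)
  case 0
  show ?case by (simp add: alternating_convolution_def)
next
  case (Suc k)
  thus ?case
    using alternating_convolution_Suc_Suc[OF assms, of "Suc (2 * k)"]
      one_minus_power_nonzero[OF assms, of "Suc (Suc (Suc (2 * k)))"]
    by (simp del: power_Suc)
qed

lemma alternating_convolution_even:
  assumes "norm q < 1"
  shows "alternating_convolution q (2 * k) = rqfact (q\<^sup>2) k"
proof (induction k)
  case 0
  show ?case by (simp add: alternating_convolution_def)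
next
  case (Suc k)
  have q2: "norm (q\<^sup>2) < 1"
    using assms by (simp add: norm_power power_less_one_iff)
  have eq: "(q\<^sup>2) ^ Suc k = q ^ Suc (Suc (2 * k))"
    by (simp add: power_mult_distrib mult_2 power_add power2_eq_square)
  have "(1 - q ^ Suc (Suc (2 * k))) * alternating_convolution q (Suc (Suc (2 * k))) =
        (1 - q ^ Suc (Suc (2 * k))) * rqfact (q\<^sup>2) (Suc k)"
    using rqfact_Suc[OF q2, of k] Suc.IH alternating_convolution_Suc_Suc[OF assms, of "2 * k"]
    unfolding eq by (simp add: mult_ac del: power_Suc)
  thus ?case
    using one_minus_power_nonzero[OF assms, of "Suc (Suc (2 * k))"] by (simp del: power_Suc)
qed

section \<open>Euler's series for the infinite product\<close>

lemma summable_euler: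
  assumes "norm q < 1"
  shows "summable (\<lambda>m. norm ((-1) ^ m * q ^ (m choose 2) * rqfact q m * a ^ m))"
proof -
  obtain C where C: "C > 0" "\<And>n. norm (rqfact q n) \<le> C"
    using rqfact_bounded[OF assms] by blast
  show ?thesis
  proof (rule summable_comparison_test')
    show "summable (\<lambda>m. C * (norm q ^ (m choose 2) * norm a ^ m))"
      using assms by (intro summable_mult summable_power_choose_two) auto
    fix m
    have "norm (rqfact q m) * (norm q ^ (m choose 2) * norm a ^ m) \<le> C * (norm q ^ (m choose 2) * norm a ^ m)"
      using C by (intro mult_right_mono) auto
    thus "norm (norm ((-1) ^ m * q ^ (m choose 2) * rqfact q m * a ^ m)) \<le>
          C * (norm q ^ (m choose 2) * norm a ^ m)"
      by (simp add: norm_mult norm_power mult_ac)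
  qed
qed

text \<open>The series \<open>E\<close> satisfies \<open>E a = (1 - a) * E (a * q)\<close>.
  Iterating pulls out \<open>qpoch a q n\<close>, and continuity at 0 with \<open>E 0 = 1\<close>
  gives the limit.\<close>

lemma euler_qpoch_inf:
  assumes "norm q < 1"
  shows "((\<lambda>m. (-1) ^ m * q ^ (m choose 2) * rqfact q m * a ^ m) has_sum qpoch_inf a q) UNIV"
proof -
  define c where "c m = (-1) ^ m * q ^ (m choose 2) * rqfact q m" for m
  define E where "E a = (\<Sum>m. c m * a ^ m)" for a
  have summ: "summable (\<lambda>m. c m * a ^ m)" for a
    unfolding c_def by (rule summable_norm_cancel[OF summable_euler[OF assms]])
  have step: "E a = (1 - a) * E (a * q)" for a
  proof -
    \<comment> \<open>The difference produces \<open>1 - q ^ Suc m\<close>, which turns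
      \<open>rqfact q (Suc m)\<close> into \<open>rqfact q m\<close>.\<close>
    have *: "c (Suc m) * a ^ Suc m - c (Suc m) * (a * q) ^ Suc m = - a * (c m * (a * q) ^ m)" for m
    proof -
      have "c (Suc m) * a ^ Suc m - c (Suc m) * (a * q) ^ Suc m =
            (-1) ^ Suc m * q ^ (Suc m choose 2) * (rqfact q (Suc m) * (1 - q ^ Suc m)) * a ^ Suc m"
        unfolding c_def power_mult_distrib by (simp add: algebra_simps)
      also have "\<dots> = - a * (c m * (a * q) ^ m)"
        unfolding rqfact_Suc[OF assms] c_def
        by (simp add: Suc_choose_two power_add power_mult_distrib mult_ac)
      finally show ?thesis .
    qed
    have "E a - E (a * q) = (\<Sum>m. c m * a ^ m - c m * (a * q) ^ m)"
      unfolding E_def by (rule suminf_diff[OF summ summ])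
    also have "\<dots> = (\<Sum>m. c (Suc m) * a ^ Suc m - c (Suc m) * (a * q) ^ Suc m)"
      by (subst suminf_split_head[OF summable_diff[OF summ summ]]) simp
    also have "\<dots> = - a * E (a * q)"
      unfolding * E_def by (rule suminf_mult[OF summ])
    finally show ?thesis by (simp add: algebra_simps)
  qed
  have iter: "E a = qpoch a q n * E (a * q ^ n)" for n
  proof (induction n)
    case (Suc n)
    thus ?case using step[of "a * q ^ n"] by (simp add: qpoch_Suc mult_ac)
  qed simp
  have "isCont E 0"
    unfolding E_def by (rule isCont_powser_converges_everywhere[OF summ])
  moreover have "(\<lambda>n. a * q ^ n) \<longlonglongrightarrow> a * 0"
    using assms by (intro tendsto_mult tendsto_const LIMSEQ_power_zero)
  ultimately have "(\<lambda>n. E (a * q ^ n)) \<longlonglongrightarrow> E 0"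
    by (intro isCont_tendsto_compose[of 0 E]) auto
  hence "(\<lambda>n. qpoch a q n * E (a * q ^ n)) \<longlonglongrightarrow> qpoch_inf a q * E 0"
    by (intro tendsto_mult qpoch_tendsto[OF assms])
  hence "E a = qpoch_inf a q * E 0"
    unfolding iter[symmetric] by (simp add: LIMSEQ_const_iff)
  moreover have "E 0 = 1"
    unfolding E_def by (subst powser_zero) (simp add: c_def numeral_2_eq_2)
  ultimately have "(\<lambda>m. c m * a ^ m) sums qpoch_inf a q"
    using summable_sums[OF summ, of a] by (simp add: E_def)
  moreover have "summable (\<lambda>m. norm (c m * a ^ m))"
    using summable_euler[OF assms, of a] by (simp add: c_def)
  ultimately show ?thesis
    using norm_summable_imp_has_sum[of "\<lambda>m. c m * a ^ m"] by (simp add: c_def)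
qed

section \<open>The triple series and its absolute convergence\<close>

text \<open>The exponent equals \<open>((j + r) choose 2) + (j choose 2) + (m choose 2) + m * (j +
  r)\<close>, as the right-hand side produces it, but is written to show that only \<open>j\<close>
  and \<open>r + m\<close> matter.\<close>

definition triple_term :: "complex \<Rightarrow> complex \<Rightarrow> complex \<Rightarrow> nat \<times> nat \<times> nat \<Rightarrow> complex" where
  "triple_term q x y = (\<lambda>(j, r, m).
     (-1) ^ m * q ^ (2 * (j choose 2) + ((r + m) choose 2) + j * (r + m)) * x ^ j * y ^ (r + m) *
     (rqfact q j * rqfact q r * rqfact q m))"

lemma summable_on_product_nonneg:
  fixes f :: "'a \<Rightarrow> real" and g :: "'b \<Rightarrow> real"
  assumes "f summable_on A" "g summable_on B" "\<And>x. f x \<ge> 0" "\<And>y. g y \<ge> 0"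
  shows "(\<lambda>(x, y). f x * g y) summable_on A \<times> B"
proof (rule summable_on_SigmaI)
  show "((\<lambda>y. case (x, y) of (x, y) \<Rightarrow> f x * g y) has_sum f x * infsum g B) B" for x
    using has_sum_cmult_right[OF has_sum_infsum[OF assms(2)], of "f x"] by simp
  show "(\<lambda>x. f x * infsum g B) summable_on A"
    by (rule summable_on_cmult_left[OF assms(1)])
qed (use assms in auto)

text \<open>Since \<open>norm q < 1\<close>, dropping one \<open>j choose 2\<close> and the cross
  terms from the exponent only enlarges the norm. What remains is a product of three convergent
  single series.\<close>

lemma triple_term_summable:
  assumes "norm q < 1"
  shows "triple_term q x y summable_on UNIV"
proof -
  obtain C where C: "C > 0" "\<And>n. norm (rqfact q n) \<le> C"
    using rqfact_bounded[OF assms] by blast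
  define Q where "Q = norm q"
  have Q: "0 \<le> Q" "Q < 1" using assms by (auto simp: Q_def)
  define u where "u X n = C * (Q ^ (n choose 2) * X ^ n)" for X :: real and n
  have u_summable: "u X summable_on UNIV" and u_nonneg: "u X n \<ge> 0" if "X \<ge> 0" for X n
    using summable_power_choose_two[OF Q that] C Q that
    by (auto simp: u_def[abs_def] summable_on_UNIV_nonneg_real_iff intro!: summable_mult)
  have "(\<lambda>(j, r, m). u (norm x) j * (u (norm y) r * u (norm y) m)) summable_on UNIV \<times> UNIV \<times> UNIV"
    using summable_on_product_nonneg[OF u_summable[of "norm x"]
        summable_on_product_nonneg[OF u_summable[of "norm y"] u_summable[of "norm y"]]]
    by (auto simp: u_nonneg case_prod_unfold)
  moreover have "norm (triple_term q x y p) \<le>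
      (\<lambda>(j, r, m). u (norm x) j * (u (norm y) r * u (norm y) m)) p" for p
  proof (cases p)
    case fields: (fields j r m)
    have "norm (triple_term q x y p) =
          norm (rqfact q j) * norm (rqfact q r) * norm (rqfact q m) *
          (Q ^ (2 * (j choose 2) + ((r + m) choose 2) + j * (r + m)) *
           (norm x ^ j * norm y ^ (r + m)))"
      by (simp add: fields triple_term_def norm_mult norm_power Q_def mult_ac)
    also have "\<dots> \<le> C * C * C *
          (Q ^ ((j choose 2) + (r choose 2) + (m choose 2)) * (norm x ^ j * norm y ^ (r + m)))"
    proof (rule mult_mono)
      show "norm (rqfact q j) * norm (rqfact q r) * norm (rqfact q m) \<le> C * C * C"
        using C by (intro mult_mono) auto
      show "Q ^ (2 * (j choose 2) + ((r + m) choose 2) + j * (r + m)) * (norm x ^ j * norm y ^ (r + m)) \<le>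
            Q ^ ((j choose 2) + (r choose 2) + (m choose 2)) * (norm x ^ j * norm y ^ (r + m))"
        using Q by (intro mult_right_mono power_decreasing) (auto simp: add_choose_two)
    qed (use C Q in auto)
    also have "\<dots> = u (norm x) j * (u (norm y) r * u (norm y) m)"
      by (simp add: u_def power_add mult_ac)
    finally show ?thesis by (simp add: fields)
  qed
  ultimately have "(\<lambda>p. norm (triple_term q x y p)) summable_on UNIV"
    unfolding UNIV_Times_UNIV by (rule Infinite_Sum.abs_summable_on_comparison_test')
  thus ?thesis by (rule abs_summable_summable)
qed

section \<open>The two groupings of the triple series\<close>

lemma has_sum_even:
  fixes f :: "'a \<times> nat \<Rightarrow> 'b :: {comm_monoid_add, topological_space}"
  assumes "(f has_sum S) UNIV" "\<And>j k. f (j, Suc (2 * k)) = 0"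
  shows "((\<lambda>(j, k). f (j, 2 * k)) has_sum S) UNIV"
proof -
  have "f (j, n) = 0" if "(j, n) \<notin> range (\<lambda>(j, k). (j, 2 * k))" for j n
  proof (cases "even n")
    case True
    thus ?thesis using that by (auto elim!: evenE)
  qed (auto elim!: oddE simp: assms(2))
  hence "(f has_sum S) (range (\<lambda>(j, k). (j, 2 * k)))"
    by (subst has_sum_cong_neutral[of UNIV _ f f]) (use assms(1) in auto)
  hence "((f \<circ> (\<lambda>(j, k). (j, 2 * k))) has_sum S) UNIV"
    by (subst (asm) has_sum_reindex) (auto simp: inj_on_def)
  thus ?thesis by (simp add: o_def case_prod_unfold)
qed

lemma has_sum_lhs_term:
  assumes "norm q < 1" "(triple_term q x y has_sum S) UNIV"
  shows "(lhs_term q x y has_sum S) UNIV"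
proof -
  define g where "g = (\<lambda>(j, n). q ^ (2 * (j choose 2) + (n choose 2) + j * n) * x ^ j * y ^ n *
      rqfact q j * alternating_convolution q n)"
  \<comment> \<open>The bound \<open>m \<le> n\<close> keeps \<open>n - m\<close> exact, so
    \<open>n = r + m\<close> inverts the map.\<close>
  have "bij_betw (\<lambda>((j, n), m). (j, n - m, m)) (Sigma UNIV (\<lambda>(j, n). {..n}))
      (UNIV :: (nat \<times> nat \<times> nat) set)"
    by (rule bij_betw_byWitness[where f' = "\<lambda>(j, r, m). ((j, r + m), m)"]) auto
  from has_sum_reindex_bij_betw[OF this, of "triple_term q x y" S]
  have "((\<lambda>p. triple_term q x y (fst (fst p), snd (fst p) - snd p, snd p)) has_sum S)
      (Sigma UNIV (\<lambda>p. {..snd p}))"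
    using assms(2) by (simp add: case_prod_unfold)
  hence "(g has_sum S) UNIV"
  proof (rule has_sum_SigmaD)
    fix p :: "nat \<times> nat"
    obtain j n where p: "p = (j, n)" by (cases p)
    have "(\<Sum>m\<le>n. triple_term q x y (j, n - m, m)) = g (j, n)"
      unfolding g_def alternating_convolution_def prod.case sum_distrib_left
      by (intro sum.cong) (auto simp: triple_term_def)
    thus "((\<lambda>m. triple_term q x y (fst (fst (p, m)), snd (fst (p, m)) - snd (p, m), snd (p, m)))
            has_sum g p) {..snd p}"
      by (auto simp: p intro!: has_sum_finiteI)
  qed
  hence "((\<lambda>(j, k). g (j, 2 * k)) has_sum S) UNIV"
    by (rule has_sum_even) (simp add: g_def alternating_convolution_odd[OF assms(1)])
  moreover have "g (j, 2 * k) = lhs_term q x y (j, k)" for j k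
  proof -
    \<comment> \<open>Replacing each square by \<open>n + 2 * (n choose 2)\<close> makes the
      subtraction of \<open>j\<close> and \<open>k\<close> visibly exact.\<close>
    have "2 * (j choose 2) + ((2 * k) choose 2) + j * (2 * k) = j\<^sup>2 + 2 * j * k + 2 * k\<^sup>2 - j - k"
      using add_choose_two[of k k] unfolding square_eq_choose_two mult_2[symmetric]
      using square_eq_choose_two[of k] by (simp add: power2_eq_square)
    thus ?thesis
      unfolding g_def lhs_term_def prod.case alternating_convolution_even[OF assms(1)]
      by (simp add: rqfact_def field_simps)
  qed
  ultimately show ?thesis by (simp add: case_prod_unfold)
qed

definition rhs_entire_term :: "complex \<Rightarrow> complex \<Rightarrow> complex \<Rightarrow> nat \<Rightarrow> complex" where
  "rhs_entire_term q x y k =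
     q ^ (k choose 2) * rqfact q k * (\<Prod>i<k. y + x * q ^ i) * qpoch_inf (y * q ^ k) q"

text \<open>The triples are grouped by \<open>k = j + r\<close>: Euler's series at
  \<open>y * q ^ k\<close> sums over \<open>m\<close>, then \<open>q_binomial\<close> sums over
  \<open>j\<close>. Any \<open>y\<close> is allowed, as no denominator contains it.\<close>

lemma has_sum_rhs_entire_term:
  assumes "norm q < 1" "(triple_term q x y has_sum S) UNIV"
  shows "(rhs_entire_term q x y has_sum S) UNIV"
proof -
  define h where "h = (\<lambda>(k, j). q ^ (k choose 2) * qpoch_inf (y * q ^ k) q *
      (q ^ (j choose 2) * x ^ j * y ^ (k - j) * rqfact q j * rqfact q (k - j)))"
  let ?I = "Sigma UNIV (\<lambda>k::nat. {..k})"
  have "bij_betw (\<lambda>((k, j), m). (j, k - j, m)) (?I \<times> UNIV) (UNIV :: (nat \<times> nat \<times> nat) set)"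
    by (rule bij_betw_byWitness[where f' = "\<lambda>(j, r, m). ((j + r, j), m)"]) auto
  from has_sum_reindex_bij_betw[OF this, of "triple_term q x y" S]
  have "((\<lambda>p. triple_term q x y (snd (fst p), fst (fst p) - snd (fst p), snd p)) has_sum S) (?I \<times> UNIV)"
    using assms(2) by (simp add: case_prod_unfold)
  hence "(h has_sum S) ?I"
  proof (rule has_sum_SigmaD)
    fix p assume "p \<in> ?I"
    then obtain j r where p: "p = (j + r, j)"
      by (auto simp: le_iff_add)
    have "triple_term q x y (j, r, m) =
          q ^ ((j + r) choose 2) * (q ^ (j choose 2) * x ^ j * y ^ r * rqfact q j * rqfact q r) *
          ((-1) ^ m * q ^ (m choose 2) * rqfact q m * (y * q ^ (j + r)) ^ m)" for m
      by (simp add: triple_term_def add_choose_two power_add power_mult power_mult_distrib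
          algebra_simps power2_eq_square)
    thus "((\<lambda>m. triple_term q x y (snd (fst (p, m)), fst (fst (p, m)) - snd (fst (p, m)), snd (p, m)))
            has_sum h p) UNIV"
      using has_sum_cmult_right[OF euler_qpoch_inf[OF assms(1), of "y * q ^ (j + r)"],
          of "q ^ ((j + r) choose 2) * (q ^ (j choose 2) * x ^ j * y ^ r * rqfact q j * rqfact q r)"]
      by (simp add: p h_def mult_ac)
  qed
  thus ?thesis
  proof (rule has_sum_SigmaD)
    fix k
    have "(\<Sum>j\<le>k. h (k, j)) = rhs_entire_term q x y k"
      unfolding h_def prod.case sum_distrib_left[symmetric] q_binomial[OF assms(1)]
      by (simp add: rhs_entire_term_def mult_ac)
    thus "((\<lambda>j. h (k, j)) has_sum rhs_entire_term q x y k) {..k}"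
      by (auto intro!: has_sum_finiteI)
  qed
qed

section \<open>The identity at regular \<open>y\<close>\<close>

text \<open>Distributing \<open>y ^ k\<close> over the factors of \<open>qpoch (- x / y) q k\<close>
  clears \<open>x / y\<close>, and \<open>qpoch y q k\<close> cancels the first \<open>k\<close>
  factors of \<open>qpoch_inf y q\<close>.\<close>

lemma rhs_entire_term_eq:
  assumes "norm q < 1" "regular q y"
  shows "rhs_entire_term q x y k = qpoch_inf y q * rhs_term q x y k"
proof -
  have y: "y \<noteq> 0" "qpoch y q k \<noteq> 0"
    using assms(2) by (auto simp: regular_def)
  have "(\<Prod>i<k. y + x * q ^ i) = qpoch (- x / y) q k * y ^ k"
    using y by (induction k) (auto simp: qpoch_Suc field_simps)
  thus ?thesis
    using y qpoch_inf_split[OF assms(1), of y k]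
    by (simp add: rhs_entire_term_def rhs_term_def rqfact_def field_simps)
qed

lemma has_sum_lhs_term_infsum:
  assumes "norm q < 1"
  shows "(lhs_term q x y has_sum infsum (lhs_term q x y) UNIV) UNIV"
  using has_sum_lhs_term[OF assms has_sum_infsum[OF triple_term_summable[OF assms]]]
  by (intro has_sum_infsum) (rule has_sum_imp_summable)

lemma regular_identity:
  assumes "norm q < 1" "regular q y"
  shows "rhs_term q x y sums (infsum (lhs_term q x y) UNIV / qpoch_inf y q)"
proof -
  have "(triple_term q x y has_sum infsum (triple_term q x y) UNIV) UNIV"
    by (rule has_sum_infsum[OF triple_term_summable[OF assms(1)]])
  from has_sum_lhs_term[OF assms(1) this] has_sum_rhs_entire_term[OF assms(1) this]
  have "(rhs_entire_term q x y has_sum infsum (lhs_term q x y) UNIV) UNIV"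
    by (simp add: infsumI)
  hence "(\<lambda>k. qpoch_inf y q * rhs_term q x y k) sums infsum (lhs_term q x y) UNIV"
    unfolding rhs_entire_term_eq[OF assms, abs_def] by (rule has_sum_imp_sums)
  from sums_divide[OF this, of "qpoch_inf y q"] show ?thesis
    using qpoch_inf_nonzero[OF assms(1), of y] assms(2) by (simp add: regular_def)
qed

section \<open>Continuity and removable singularities in \<open>y\<close>\<close>

text \<open>Summing over \<open>j\<close> first exhibits the left-hand side as an everywhere
  convergent power series in \<open>y\<^sup>2\<close>, with coefficients read off at
  \<open>y = 1\<close>.\<close>

lemma isCont_lhs:
  assumes "norm q < 1"
  shows "isCont (\<lambda>y. infsum (lhs_term q x y) UNIV) z"
proof -
  define A where "A k = (\<Sum>\<^sub>\<infinity>j. lhs_term q x 1 (j, k))" for k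
  have A: "((\<lambda>j. lhs_term q x 1 (j, k)) has_sum A k) UNIV" for k
  proof -
    have "lhs_term q x 1 summable_on UNIV \<times> UNIV"
      using has_sum_lhs_term_infsum[OF assms] by (auto simp: summable_on_def)
    hence "(\<lambda>(k, j). lhs_term q x 1 (j, k)) summable_on UNIV \<times> UNIV"
      by (subst summable_on_swap) auto
    thus ?thesis
      unfolding A_def by (intro has_sum_infsum) (drule summable_on_SigmaD1[where x = k]; simp)
  qed
  have sums: "(\<lambda>k. A k * (y\<^sup>2) ^ k) sums infsum (lhs_term q x y) UNIV" for y
  proof (rule has_sum_imp_sums, rule has_sum_SigmaD)
    show "((\<lambda>(k, j). lhs_term q x y (j, k)) has_sum infsum (lhs_term q x y) UNIV) (UNIV \<times> UNIV)"
      using has_sum_lhs_term_infsum[OF assms, of x y] by (subst has_sum_swap) auto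
    show "((\<lambda>j. case (k, j) of (k, j) \<Rightarrow> lhs_term q x y (j, k)) has_sum A k * (y\<^sup>2) ^ k) UNIV" for k
      using has_sum_cmult_left[OF A[of k], of "(y\<^sup>2) ^ k"]
      by (simp add: lhs_term_def power_mult)
  qed
  \<comment> \<open>Convergence is known only at squares, and \<open>csqrt\<close> writes every
    \<open>w\<close> as one.\<close>
  have "summable (\<lambda>k. A k * w ^ k)" for w
    using sums[of "csqrt w"] by (auto simp: sums_iff)
  hence "isCont (\<lambda>w. \<Sum>k. A k * w ^ k) (z\<^sup>2)"
    by (rule isCont_powser_converges_everywhere)
  hence "isCont (\<lambda>y. \<Sum>k. A k * (y\<^sup>2) ^ k) z"
    by (rule isCont_o2[rotated]) simp
  thus ?thesis using sums by (simp add: sums_iff)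
qed

text \<open>Only finitely many singular values lie in the unit ball around \<open>y\<close>, and a
  finite set has no limit point.\<close>

lemma eventually_regular:
  assumes "norm q < 1"
  shows "eventually (\<lambda>z. regular q z) (at y)"
proof -
  define R where "R = norm y + 1"
  have "(\<lambda>n. R * norm q ^ n) \<longlonglongrightarrow> R * 0"
    using assms by (intro tendsto_mult tendsto_const LIMSEQ_power_zero) simp
  hence "eventually (\<lambda>n. R * norm q ^ n < 1) sequentially"
    by (intro order_tendstoD[where y = "R * 0"]) auto
  then obtain N where N: "\<And>n. n \<ge> N \<Longrightarrow> R * norm q ^ n < 1"
    by (auto simp: eventually_sequentially)
  \<comment> \<open>If \<open>q = 0\<close>, the inverses with \<open>i > 0\<close> default to 0,
    which is excluded anyway.\<close>
  let ?B = "insert 0 ((\<lambda>i. inverse (q ^ i)) ` {..<N})"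
  have "eventually (\<lambda>z. z \<notin> ?B) (at y)"
    using islimpt_finite[of ?B y] by (simp add: islimpt_iff_eventually)
  moreover have "eventually (\<lambda>z. z \<in> ball y 1) (at y)"
    by (intro eventually_at_in_open') auto
  ultimately show ?thesis
  proof eventually_elim
    case (elim z)
    have "norm z \<le> R"
      using elim(2) norm_triangle_ineq[of y "z - y"] by (simp add: R_def dist_norm norm_minus_commute)
    have "1 - z * q ^ i \<noteq> 0" for i
    proof
      assume "1 - z * q ^ i = 0"
      hence eq: "z * q ^ i = 1" by simp
      hence "z = inverse (q ^ i)" 
        by (metis inverse_unique mult.commute)
      hence "i \<ge> N" using elim(1) by force
      have "norm (z * q ^ i) \<le> R * norm q ^ i"
        using \<open>norm z \<le> R\<close> by (simp add: norm_mult norm_power mult_right_mono)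
      also have "\<dots> < 1" by (rule N[OF \<open>i \<ge> N\<close>])
      finally show False by (simp add: eq)
    qed
    thus ?case using elim(1) by (auto simp: regular_def qpoch_def)
  qed
qed

theorem theorem1p1:
  fixes q x y :: complex
  assumes "norm q < 1"
  shows "lhs_term q x y summable_on UNIV \<and>
    (regular q y \<longrightarrow>
       summable (rhs_term q x y) \<and>
       (\<Sum>\<^sub>\<infinity>(j, k)\<in>UNIV. lhs_term q x y (j, k)) = qpoch_inf y q * (\<Sum>k. rhs_term q x y k)) \<and>
    (\<not> regular q y \<longrightarrow>
       ((\<lambda>z. qpoch_inf z q * (\<Sum>k. rhs_term q x z k)) \<longlongrightarrow>
         (\<Sum>\<^sub>\<infinity>(j, k)\<in>UNIV. lhs_term q x y (j, k))) (at y))"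
proof -
  have summable: "lhs_term q x y summable_on UNIV"
    using has_sum_lhs_term_infsum[OF assms] by (auto simp: summable_on_def)
  have eq: "infsum (lhs_term q x z) UNIV = qpoch_inf z q * (\<Sum>k. rhs_term q x z k)"
    if "regular q z" for z
    using regular_identity[OF assms that, of x] qpoch_inf_nonzero[OF assms, of z] that
    by (simp add: sums_iff regular_def)
  have "((\<lambda>z. infsum (lhs_term q x z) UNIV) \<longlongrightarrow> infsum (lhs_term q x y) UNIV) (at y)"
    using isCont_lhs[OF assms] by (simp add: isCont_def)
  moreover have "eventually (\<lambda>z. infsum (lhs_term q x z) UNIV =
      qpoch_inf z q * (\<Sum>k. rhs_term q x z k)) (at y)"
    using eventually_regular[OF assms] by eventually_elim (rule eq)
  ultimately have "((\<lambda>z. qpoch_inf z q * (\<Sum>k. rhs_term q x z k)) \<longlongrightarrow>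
      infsum (lhs_term q x y) UNIV) (at y)"
    by (rule Lim_transform_eventually)
  thus ?thesis
    using summable eq[of y] regular_identity[OF assms, of y x] by (auto simp: sums_iff)
qed

end
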